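(* Let $\mathfrak{g}$ be a finite-dimensional complex Lie algebra. The cocycle $c\in C^2(\mathfrak{g}\rtimes\mathfrak{g},\mathfrak{g}\rtimes\mathfrak{g})$ defined by $c((h,g),(h',g'))=[h,h']$ (an element of the second factor $\mathfrak{g}$) is universal in the following sense: for any crossed module $\mu:\mathfrak{h}\to\mathfrak{g}$ of finite-dimensional complex Lie algebras, there is a morphism of crossed modules $(\phi,\psi):(\mu:\mathfrak{h}\to\mathfrak{g})\to(\mathrm{id}:\mathfrak{g}\to\mathfrak{g})$ via which $c$ induces the cocycle $$((h,g),(h',g'))\mapsto\mu([h,h'])$$ on $\mathfrak{h}\rtimes\mathfrak{g}$ (with value in the factor $\mathfrak{g}$), i.e. $c\big((\phi(h),\psi(g)),(\phi(h'),\psi(g'))\big)=\mu([h,h'])$ for all $h,h'\in\mathfrak{h}$ and $g,g'\in\mathfrak{g}$.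
   Context: A crossed module of Lie algebras is a Lie algebra homomorphism $\mu:\mathfrak{h}\to\mathfrak{g}$ together with an action of $\mathfrak{g}$ on $\mathfrak{h}$ by derivations, written $g\cdot h$, such that for all $g\in\mathfrak{g}$ and $h,h'\in\mathfrak{h}$: (a) $\mu(g\cdot h)=[g,\mu(h)]$, and (b) $\mu(h)\cdot h'=[h,h']$. The identity $\mathrm{id}:\mathfrak{g}\to\mathfrak{g}$ is a crossed module with the adjoint action $g\cdot h=[g,h]$. A morphism of crossed modules $(\phi,\psi):(\mu:\mathfrak{h}\to\mathfrak{g})\to(\mu':\mathfrak{h}'\to\mathfrak{g}')$ is a pair of Lie algebra morphisms $\phi:\mathfrak{h}\to\mathfrak{h}'$ and $\psi:\mathfrak{g}\to\mathfrak{g}'$ such that $\mu'\circ\phi=\psi\circ\mu$ and $\phi(g\cdot h)=\psi(g)\cdot\phi(h)$ for all $g\in\mathfrak{g}$, $h\in\mathfrak{h}$. The semi-direct product $\mathfrak{h}\rtimes\mathfrak{g}$ is the vector space $\mathfrak{h}\oplus\mathfrak{g}$ with bracket $[(h,g),(h',g')]=(g\cdot h'-g'\cdot h,[g,g'])$ ($\mathfrak{h}$ being viewed as a $\mathfrak{g}$-module and abelian Lie algebra); in particular $\mathfrak{g}\rtimes\mathfrak{g}$ has bracket $[(h,g),(h',g')]=([g,h']-[g',h],[g,g'])$. An element $x$ of the second factor $\mathfrak{g}$ of the semi-direct product is identified with $(0,x)$. $C^2(\mathfrak{l},\mathfrak{l})$ denotes Chevalley-Eilenberg $2$-cochains with values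 in the adjoint representation. *)

theory Defs
  imports "HOL-Analysis.Product_Vector"
begin

section \<open>Lie algebras\<close>

text \<open>
  A Lie algebra over a field \<open>'k\<close> lives on a whole type \<open>'a\<close>, with explicit scalar
  multiplication, as in the locale \<^locale>\<open>vector_space\<close>.
\<close>

definition bilinear_map ::
  "('k::field \<Rightarrow> 'a::ab_group_add \<Rightarrow> 'a) \<Rightarrow> ('k \<Rightarrow> 'b::ab_group_add \<Rightarrow> 'b) \<Rightarrow>
   ('k \<Rightarrow> 'c::ab_group_add \<Rightarrow> 'c) \<Rightarrow> ('a \<Rightarrow> 'b \<Rightarrow> 'c) \<Rightarrow> bool" where
  "bilinear_map s1 s2 s3 f \<longleftrightarrow>
     (\<forall>x. Vector_Spaces.linear s2 s3 (f x)) \<and> (\<forall>y. Vector_Spaces.linear s1 s3 (\<lambda>x. f x y))"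

definition finite_dim :: "('k::field \<Rightarrow> 'a::ab_group_add \<Rightarrow> 'a) \<Rightarrow> bool" where
  "finite_dim s \<longleftrightarrow> (\<exists>B. finite_dimensional_vector_space s B)"

locale lie_algebra = vector_space scale
  for scale :: "'k::field \<Rightarrow> 'a::ab_group_add \<Rightarrow> 'a" +
  fixes bracket :: "'a \<Rightarrow> 'a \<Rightarrow> 'a"
  assumes bilinear_bracket: "bilinear_map scale scale scale bracket"
    and bracket_self: "bracket x x = 0"
    and jacobi: "bracket x (bracket y z) + bracket y (bracket z x) + bracket z (bracket x y) = 0"
begin

definition C2 :: "('a \<Rightarrow> 'a \<Rightarrow> 'a) set" where
  "C2 = {c. bilinear_map scale scale scale c \<and> (\<forall>x. c x x = 0)}"

text \<open>The Chevalley-Eilenberg differential \<open>C\<^sup>2 \<rightarrow> C\<^sup>3\<close> with values in the adjoint representation.\<close>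

definition d2 :: "('a \<Rightarrow> 'a \<Rightarrow> 'a) \<Rightarrow> 'a \<Rightarrow> 'a \<Rightarrow> 'a \<Rightarrow> 'a" where
  "d2 c x y z =
     bracket x (c y z) - bracket y (c x z) + bracket z (c x y)
     - c (bracket x y) z + c (bracket x z) y - c (bracket y z) x"

end

text \<open>As a predicate, \<open>ce_2_cocycle\<close> includes that \<open>(scale, bracket)\<close> is a Lie algebra.\<close>

locale ce_2_cocycle = lie_algebra scale bracket
  for scale :: "'k::field \<Rightarrow> 'a::ab_group_add \<Rightarrow> 'a" and bracket :: "'a \<Rightarrow> 'a \<Rightarrow> 'a" +
  fixes c :: "'a \<Rightarrow> 'a \<Rightarrow> 'a"
  assumes cochain: "c \<in> C2"
    and closed: "d2 c x y z = 0"

locale lie_algebra_hom =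
  L1: lie_algebra s1 b1 + L2: lie_algebra s2 b2 + Vector_Spaces.linear s1 s2 f
  for s1 :: "'k::field \<Rightarrow> 'a::ab_group_add \<Rightarrow> 'a" and b1 :: "'a \<Rightarrow> 'a \<Rightarrow> 'a"
    and s2 :: "'k \<Rightarrow> 'b::ab_group_add \<Rightarrow> 'b" and b2 :: "'b \<Rightarrow> 'b \<Rightarrow> 'b"
    and f :: "'a \<Rightarrow> 'b" +
  assumes hom_bracket: "f (b1 x y) = b2 (f x) (f y)"


section \<open>Crossed modules\<close>

locale lie_action_by_derivations =
  H: lie_algebra sh bh + G: lie_algebra sg bg
  for sh :: "'k::field \<Rightarrow> 'h::ab_group_add \<Rightarrow> 'h" and bh :: "'h \<Rightarrow> 'h \<Rightarrow> 'h"
    and sg :: "'k \<Rightarrow> 'g::ab_group_add \<Rightarrow> 'g" and bg :: "'g \<Rightarrow> 'g \<Rightarrow> 'g" +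
  fixes act :: "'g \<Rightarrow> 'h \<Rightarrow> 'h"
  assumes bilinear_act: "bilinear_map sg sh sh act"
    and act_bracket: "act (bg g g') h = act g (act g' h) - act g' (act g h)"
    and act_derivation: "act g (bh h h') = bh (act g h) h' + bh h (act g h')"

locale crossed_module =
  lie_action_by_derivations sh bh sg bg act + lie_algebra_hom sh bh sg bg mu
  for sh :: "'k::field \<Rightarrow> 'h::ab_group_add \<Rightarrow> 'h" and bh :: "'h \<Rightarrow> 'h \<Rightarrow> 'h"
    and sg :: "'k \<Rightarrow> 'g::ab_group_add \<Rightarrow> 'g" and bg :: "'g \<Rightarrow> 'g \<Rightarrow> 'g"
    and act :: "'g \<Rightarrow> 'h \<Rightarrow> 'h" and mu :: "'h \<Rightarrow> 'g" +
  assumes equivariance: "mu (act g h) = bg g (mu h)"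
    and peiffer: "act (mu h) h' = bh h h'"

locale crossed_module_hom =
  X1: crossed_module sh1 bh1 sg1 bg1 act1 mu1 +
  X2: crossed_module sh2 bh2 sg2 bg2 act2 mu2 +
  phi: lie_algebra_hom sh1 bh1 sh2 bh2 phi +
  psi: lie_algebra_hom sg1 bg1 sg2 bg2 psi
  for sh1 :: "'k::field \<Rightarrow> 'h1::ab_group_add \<Rightarrow> 'h1" and bh1
    and sg1 :: "'k \<Rightarrow> 'g1::ab_group_add \<Rightarrow> 'g1" and bg1 and act1 and mu1
    and sh2 :: "'k \<Rightarrow> 'h2::ab_group_add \<Rightarrow> 'h2" and bh2
    and sg2 :: "'k \<Rightarrow> 'g2::ab_group_add \<Rightarrow> 'g2" and bg2 and act2 and mu2
    and phi :: "'h1 \<Rightarrow> 'h2" and psi :: "'g1 \<Rightarrow> 'g2" +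
  assumes commute: "mu2 (phi h) = psi (mu1 h)"
    and phi_act: "phi (act1 g h) = act2 (psi g) (phi h)"


section \<open>The semi-direct product and its cochains\<close>

text \<open>
  The semi-direct product is the product type with scalar multiplication
  \<^const>\<open>module_prod.scale\<close> and the bracket below. The bracket of \<open>\<hh>\<close> does not enter:
  \<open>\<hh>\<close> is regarded as an abelian Lie algebra.
\<close>

definition semidirect_bracket ::
  "('g \<Rightarrow> 'h \<Rightarrow> 'h::ab_group_add) \<Rightarrow> ('g \<Rightarrow> 'g \<Rightarrow> 'g) \<Rightarrow> 'h \<times> 'g \<Rightarrow> 'h \<times> 'g \<Rightarrow> 'h \<times> 'g" where
  "semidirect_bracket act bg = (\<lambda>(h, g) (h', g'). (act g h' - act g' h, bg g g'))"

definition universal_cochain ::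
  "('g \<Rightarrow> 'g \<Rightarrow> 'g::ab_group_add) \<Rightarrow> 'g \<times> 'g \<Rightarrow> 'g \<times> 'g \<Rightarrow> 'g \<times> 'g" where
  "universal_cochain bg = (\<lambda>(h, g) (h', g'). (0, bg h h'))"

definition crossed_cochain ::
  "('h \<Rightarrow> 'h \<Rightarrow> 'h::ab_group_add) \<Rightarrow> ('h \<Rightarrow> 'g) \<Rightarrow> 'h \<times> 'g \<Rightarrow> 'h \<times> 'g \<Rightarrow> 'h \<times> 'g" where
  "crossed_cochain bh mu = (\<lambda>(h, g) (h', g'). (0, mu (bh h h')))"

end

theory Submission
  imports Defs
begin

text \<open>
  The morphism onto the identity crossed module is \<open>(\<mu>, id)\<close>. The square commutes
  trivially, equivariance of the first component is axiom (a), and the induced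
  cochain is \<open>[\<mu> h, \<mu> h'] = \<mu> [h, h']\<close> because \<open>\<mu>\<close> is a homomorphism.

  What remains is that \<open>\<mu> \<circ> [_, _]\<close> is a cocycle on \<open>\<hh> \<rtimes> \<gg>\<close>. The
  differential has two components, and they vanish for different reasons. The first factor
  receives contributions only from the terms \<open>[x, c (y, z)]\<close>, namely
  \<open>- \<mu>[h\<^sub>2, h\<^sub>3] \<cdot> h\<^sub>1\<close> and its permutations; by the Peiffer identity (b) these are
  \<open>- [[h\<^sub>2, h\<^sub>3], h\<^sub>1]\<close>, and their alternating sum is the Jacobi identity of \<open>\<hh>\<close>. In the
  second factor, equivariance rewrites \<open>[g\<^sub>1, \<mu>[h\<^sub>2, h\<^sub>3]]\<close> as \<open>\<mu>(g\<^sub>1 \<cdot> [h\<^sub>2, h\<^sub>3])\<close>, and the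
  terms \<open>c ([x, y], z)\<close> cancel it because \<open>\<gg>\<close> acts by derivations. This is
  \<open>crossed_cochain_cocycle\<close>. The cocycle property of the universal cochain is the same
  statement for the crossed module \<open>id : \<gg> \<rightarrow> \<gg>\<close>.
\<close>

lemma bilinear_map_iff:
  assumes "vector_space s1" "vector_space s2" "vector_space s3"
  shows "bilinear_map s1 s2 s3 f \<longleftrightarrow>
    (\<forall>x y z. f (x + y) z = f x z + f y z) \<and> (\<forall>a x y. f (s1 a x) y = s3 a (f x y)) \<and>
    (\<forall>x y z. f x (y + z) = f x y + f x z) \<and> (\<forall>a x y. f x (s2 a y) = s3 a (f x y))"
  unfolding bilinear_map_def
  by (auto simp: Vector_Spaces.linear_iff assms)

lemma vector_space_prod_scale:
  assumes "vector_space s1" "vector_space s2"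
  shows "vector_space (module_prod.scale s1 s2)"
proof -
  interpret vector_space_prod s1 s2
    using assms by (intro vector_space_prod.intro vector_space_pair.intro)
  show ?thesis by (rule p.vector_space_axioms)
qed

lemma module_prod_scale_apply:
  assumes "vector_space s1" "vector_space s2"
  shows "module_prod.scale s1 s2 a (x, y) = (s1 a x, s2 a y)"
  using assms by (simp add: module_prod.scale_prod module_prod_def module_pair_def module_iff_vector_space)

lemma bilinear_map_arith:
  assumes "bilinear_map s1 s2 s3 f"
  shows "f (x + y) z = f x z + f y z" "f (x - y) z = f x z - f y z" "f (- x) z = - f x z"
    "f 0 z = 0" "f (s1 a x) z = s3 a (f x z)"
    "f u (v + w) = f u v + f u w" "f u (v - w) = f u v - f u w" "f u (- v) = - f u v"
    "f u 0 = 0" "f u (s2 a v) = s3 a (f u v)"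
proof -
  interpret l: Vector_Spaces.linear s1 s3 "\<lambda>x. f x z"
    using assms by (simp add: bilinear_map_def)
  interpret r: Vector_Spaces.linear s2 s3 "f u"
    using assms by (simp add: bilinear_map_def)
  show "f (x + y) z = f x z + f y z" "f (x - y) z = f x z - f y z" "f (- x) z = - f x z"
    "f 0 z = 0" "f (s1 a x) z = s3 a (f x z)"
    by (rule l.add l.diff l.neg l.zero l.scale)+
  show "f u (v + w) = f u v + f u w" "f u (v - w) = f u v - f u w" "f u (- v) = - f u v"
    "f u 0 = 0" "f u (s2 a v) = s3 a (f u v)"
    by (rule r.add r.diff r.neg r.zero r.scale)+
qed

context lie_algebra
begin

lemmas bracket_arith = bilinear_map_arith[OF bilinear_bracket]

lemma bracket_swap: "bracket x y = - bracket y x"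
proof -
  have "bracket x y + bracket y x = bracket (x + y) (x + y) - bracket x x - bracket y y"
    unfolding bracket_arith by (simp add: algebra_simps)
  then have "bracket x y + bracket y x = 0" by (simp add: bracket_self)
  then show ?thesis by (simp add: eq_neg_iff_add_eq_0)
qed

text \<open>
  The Jacobi identity, read as the statement that \<open>ad\<close> is a representation; moving the second
  term to the other side shows that \<open>ad x\<close> is a derivation. In this form it also serves as a
  rewrite rule that removes left-nested brackets.
\<close>

lemma bracket_bracket: "bracket (bracket x y) z = bracket x (bracket y z) - bracket y (bracket x z)"
  using jacobi[of x y z] bracket_swap[of z "bracket x y"] bracket_swap[of z x]
  by (simp add: bracket_arith algebra_simps)

lemma adjoint_action: "lie_action_by_derivations scale bracket scale bracket bracket"
proof unfold_locales
  show "bilinear_map scale scale scale bracket" by (rule bilinear_bracket)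
  show "bracket (bracket g g') h = bracket g (bracket g' h) - bracket g' (bracket g h)" for g g' h
    by (rule bracket_bracket)
  show "bracket g (bracket h h') = bracket (bracket g h) h' + bracket h (bracket g h')" for g h h'
    by (simp add: bracket_bracket)
qed

lemma identity_hom: "lie_algebra_hom scale bracket scale bracket id"
  by (simp add: lie_algebra_hom_def lie_algebra_axioms lie_algebra_hom_axioms_def linear_id)

lemma identity_crossed_module: "crossed_module scale bracket scale bracket bracket id"
  by (simp add: crossed_module_def crossed_module_axioms_def adjoint_action identity_hom)

end

context lie_action_by_derivations
begin

lemmas act_arith = bilinear_map_arith[OF bilinear_act]

text \<open>
  As \<open>\<hh>\<close> is taken to be abelian here, only the module structure enters: the
  \<open>\<hh>\<close>-component of the Jacobi identity reduces to \<open>act_bracket\<close>.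
\<close>

lemma semidirect_lie_algebra:
  "lie_algebra (module_prod.scale sh sg) (semidirect_bracket act bg)"
proof -
  note vs = H.vector_space_axioms G.vector_space_axioms
  note vsp = vector_space_prod_scale[OF vs]
  note sc = module_prod_scale_apply[OF vs]
  show ?thesis
  proof (intro lie_algebra.intro lie_algebra_axioms.intro vsp)
    show "bilinear_map (module_prod.scale sh sg) (module_prod.scale sh sg)
            (module_prod.scale sh sg) (semidirect_bracket act bg)"
      by (auto simp: bilinear_map_iff vsp semidirect_bracket_def sc act_arith G.bracket_arith
          H.scale_right_diff_distrib)
    show "semidirect_bracket act bg x x = 0" for x
      by (cases x) (simp add: semidirect_bracket_def G.bracket_self zero_prod_def)
    show "semidirect_bracket act bg x (semidirect_bracket act bg y z) +
      semidirect_bracket act bg y (semidirect_bracket act bg z x) +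
      semidirect_bracket act bg z (semidirect_bracket act bg x y) = 0" for x y z
      by (cases x; cases y; cases z)
        (simp add: semidirect_bracket_def zero_prod_def G.jacobi act_arith act_bracket)
  qed
qed

end

context crossed_module
begin

lemma crossed_cochain_cocycle:
  "ce_2_cocycle (module_prod.scale sh sg) (semidirect_bracket act bg) (crossed_cochain bh mu)"
proof -
  note vs = H.vector_space_axioms G.vector_space_axioms
  note vsp = vector_space_prod_scale[OF vs]
  note sc = module_prod_scale_apply[OF vs]
  interpret S: lie_algebra "module_prod.scale sh sg" "semidirect_bracket act bg"
    by (rule semidirect_lie_algebra)
  show ?thesis
  proof (intro ce_2_cocycle.intro ce_2_cocycle_axioms.intro S.lie_algebra_axioms)
    show "crossed_cochain bh mu \<in> S.C2"
      by (auto simp: S.C2_def bilinear_map_iff vsp crossed_cochain_def sc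
          H.bracket_arith H.bracket_self add scale zero zero_prod_def)
    show "S.d2 (crossed_cochain bh mu) x y z = 0" for x y z
    proof (cases x; cases y; cases z)
      fix h1 g1 h2 g2 h3 g3
      assume xyz: "x = (h1, g1)" "y = (h2, g2)" "z = (h3, g3)"
      \<comment> \<open>the Jacobi identity in \<open>\<hh>\<close>\<close>
      have fst: "- bh (bh h2 h3) h1 + bh (bh h1 h3) h2 - bh (bh h1 h2) h3 = 0"
        using H.bracket_bracket[of h1 h2 h3] H.bracket_swap[of "bh h2 h3" h1] H.bracket_swap[of "bh h1 h3" h2]
        by simp
      \<comment> \<open>each \<open>g\<^sub>i\<close> contributes one instance of the derivation rule, up to antisymmetry\<close>
      have snd: "act g1 (bh h2 h3) - act g2 (bh h1 h3) + act g3 (bh h1 h2)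
          - bh (act g1 h2 - act g2 h1) h3 + bh (act g1 h3 - act g3 h1) h2
          - bh (act g2 h3 - act g3 h2) h1 = 0"
        using H.bracket_swap[of h2 "act g1 h3"] H.bracket_swap[of h1 "act g2 h3"] 
          H.bracket_swap[of h1 "act g3 h2"]
        by (simp add: act_derivation H.bracket_arith)
      have "S.d2 (crossed_cochain bh mu) x y z =
        (- bh (bh h2 h3) h1 + bh (bh h1 h3) h2 - bh (bh h1 h2) h3,
         mu (act g1 (bh h2 h3) - act g2 (bh h1 h3) + act g3 (bh h1 h2)
          - bh (act g1 h2 - act g2 h1) h3 + bh (act g1 h3 - act g3 h1) h2
          - bh (act g2 h3 - act g3 h2) h1))"
        unfolding xyz S.d2_def
        by (simp add: crossed_cochain_def semidirect_bracket_def act_arith peiffer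
            equivariance add diff)
      then show ?thesis by (simp only: fst snd zero zero_prod_def)
    qed
  qed
qed

text \<open>
  The only condition with content is \<open>\<mu> (g \<cdot> h) = [g, \<mu> h]\<close>: for the adjoint action, axiom (a)
  is the compatibility of \<open>\<mu>\<close> with the actions.
\<close>

lemma hom_to_identity: "crossed_module_hom sh bh sg bg act mu sg bg sg bg bg id mu id"
  by (simp add: crossed_module_hom_def crossed_module_hom_axioms_def crossed_module_axioms
      G.identity_crossed_module G.identity_hom lie_algebra_hom_axioms equivariance)

end

theorem theorem3p7:
  fixes sg :: "complex \<Rightarrow> 'g::ab_group_add \<Rightarrow> 'g" and bg :: "'g \<Rightarrow> 'g \<Rightarrow> 'g"
  assumes "lie_algebra sg bg" and "finite_dim sg"
  shows "ce_2_cocycle (module_prod.scale sg sg) (semidirect_bracket bg bg) (universal_cochain bg) \<and>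
    (\<forall>(sh :: complex \<Rightarrow> 'h::ab_group_add \<Rightarrow> 'h) bh act mu.
       crossed_module sh bh sg bg act mu \<and> finite_dim sh \<longrightarrow>
       ce_2_cocycle (module_prod.scale sh sg) (semidirect_bracket act bg) (crossed_cochain bh mu) \<and>
       (\<exists>phi psi.
          crossed_module_hom sh bh sg bg act mu sg bg sg bg bg id phi psi \<and>
          (\<forall>h h' g g'. universal_cochain bg (phi h, psi g) (phi h', psi g') = (0, mu (bh h h')))))"
proof (intro conjI allI impI; (elim conjE)?)
  interpret lie_algebra sg bg by (rule assms(1))
  have "universal_cochain bg = crossed_cochain bg id"
    by (simp add: universal_cochain_def crossed_cochain_def)
  then show "ce_2_cocycle (module_prod.scale sg sg) (semidirect_bracket bg bg) (universal_cochain bg)"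
    using crossed_module.crossed_cochain_cocycle[OF identity_crossed_module] by simp
next
  fix sh :: "complex \<Rightarrow> 'h \<Rightarrow> 'h" and bh act mu
  assume "crossed_module sh bh sg bg act mu"
  then interpret crossed_module sh bh sg bg act mu .
  show "ce_2_cocycle (module_prod.scale sh sg) (semidirect_bracket act bg) (crossed_cochain bh mu)"
    by (rule crossed_cochain_cocycle)
  show "\<exists>phi psi.
      crossed_module_hom sh bh sg bg act mu sg bg sg bg bg id phi psi \<and>
      (\<forall>h h' g g'. universal_cochain bg (phi h, psi g) (phi h', psi g') = (0, mu (bh h h')))"
    using hom_to_identity by (auto simp: universal_cochain_def hom_bracket)
qed

end
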